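(* Let $r_p,h_p,r_v,a_{lo},a_{max},c$ be real parameters and $r,h,v,w,v_{lo}$ real state variables. The following differential game logic formula is valid: $$\Big(r_p\ge 0\wedge h_p>0\wedge r_v\ge 0\wedge a_{lo}>0\wedge c>0\wedge(w=-1\vee w=1)\wedge a_{max}\ge a_{lo}+c\wedge L^{-1}_{impl}(r,h,v,w,v_{lo})\Big)\to[\alpha_2^*]\big(|r|>r_p\vee|h|>h_p\big),$$ where $$\alpha_2\equiv\Big(?\mathit{true}\cup\big((w:=1\cup w:=-1);\ v_{lo}:=*;\ ?L^{-1}_{impl}(r,h,v,w,v_{lo});\ \mathit{adv}:=(w,v_{lo})\big)\Big);\ \big(a_o:=*;\ ?(-a_{max}\le a_o\le a_{max})\big)^d;\ \Big(a_i:=*;\ ?(-c<a_i<c);\ \{r'=-r_v,\ h'=-v,\ v'=a_o-a_i\}\Big)^*.$$ That is, from every state satisfying the precondition, the ownship has a winning strategy guaranteeing no near mid-air collision against every vertically-maneuvering intruder with $|a_i|<c$.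
   Context: Game semantics (differential game logic dGL). A hybrid game is played between the ownship (the player who must establish the postcondition) and the opponent. A formula $P\to[\alpha]Q$ is valid iff from every state (assignment of reals to all variables) satisfying $P$ the ownship has a strategy in game $\alpha$ such that every play it allows ends (whenever it ends) in a state satisfying $Q$. Game constructs: $x:=e$ assigns; $x:=*$ lets the opponent pick an arbitrary real value for $x$; $?\phi$ is a test: if $\phi$ is false the opponent loses; $\alpha;\beta$ sequential composition; $\alpha\cup\beta$ the opponent chooses which to play; $\alpha^*$ the opponent decides before each round whether to play another round or stop ($Q$ must hold after every finite number of rounds, including zero); $\{x'=f(x)\ \&\ D\}$ follows the differential equations for a nonnegative duration chosen by the opponent with $D$ true throughout (no domain means $D\equiv\mathit{true}$); $\alpha^d$ swaps roles inside $\alpha$: the ownship makes all choices there, and a failed test there makes the ownship lose. $\mathit{adv}:=(w,v_{lo})$ is a bookkeeping assignment to a variable not occurring elsewhere. Interpretation: $r,h$ horizontal/vertical separation of intruder relative to ownship, $v$ relative vertical velocity, $r_v$ horizontal closure rate, $a_o$ ownship and $a_i$ intruder vertical acceleration, $c$ bound on intruder acceleration, $(w,v_{lo})$ advisory. Safe region: $T_{lo}(v,w,v_{lo})\equiv\frac{\max(0,w(v_{lo}-v))}{a_{lo}}$; $A_{lo}(v,w,v_{lo},h_n,t)\equiv\big(0\le t<T_{lo}(v,w,v_{lo})\wedge h_n=\frac{wa_{lo}}{2}t^2+vt\big)\vee\big(t\ge T_{lo}(v,w,v_{lo})\wedge h_n=v_{lo}t-\frac{w\max(0,w(v_{lo}-v))^2}{2a_{lo}}\big)$;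 $L^{-1}_{impl}(r,h,v,w,v_{lo})\equiv\forall t\,\forall r_n\,\forall h_n\big(r_n=r_vt\wedge A_{lo}(v,w,v_{lo},h_n,t)\to(|r-r_n|>r_p\vee w(h_n-h)>h_p)\big)$. *)

theory Defs
  imports Complex_Main
begin

section \<open>Differential game logic\<close>

text \<open>
  Terms and formulas are represented by their denotations, functions on states;
  hybrid games are a datatype.
\<close>

type_synonym 'v state = "'v \<Rightarrow> real"
type_synonym 'v trm = "'v state \<Rightarrow> real"
type_synonym 'v fml = "'v state \<Rightarrow> bool"

datatype 'v game =
    Assign 'v "'v trm"
  | AssignAny 'v
  | Test "'v fml"
  | Seq "'v game" "'v game"  (infixr \<open>\<^bold>;\<close> 60)
  | Choice "'v game" "'v game"  (infixr \<open>\<^bold>\<union>\<close> 55)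
  | Loop "'v game"
  | ODE "'v \<Rightarrow> 'v trm option" "'v fml"
  | Dual "'v game"

text \<open>
  \<open>follows f D T \<phi>\<close>: on the time interval from \<open>0\<close> to \<open>T\<close> the curve \<open>\<phi>\<close> solves
  \<open>x' = e\<close> for every \<open>x\<close> with \<open>f x = Some e\<close>, stays in \<open>D\<close>, and leaves
  all other variables unchanged. At the end points the derivatives are one-sided.
\<close>

definition follows ::
  "('v \<Rightarrow> 'v trm option) \<Rightarrow> 'v fml \<Rightarrow> real \<Rightarrow> (real \<Rightarrow> 'v state) \<Rightarrow> bool" where
  "follows f D T \<phi> \<longleftrightarrow>
     (\<forall>t\<in>{0..T}. D (\<phi> t) \<and>
        (\<forall>x. case f x of
               None \<Rightarrow> \<phi> t x = \<phi> 0 x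
             | Some e \<Rightarrow> ((\<lambda>u. \<phi> u x) has_real_derivative e (\<phi> t)) (at t within {0..T})))"

text \<open>
  The winning-region semantics of dGL, always from the point of view of the ownship, who has
  to establish \<open>Q\<close>. In \<open>box \<alpha> Q\<close> the choices in \<open>\<alpha>\<close> belong to the opponent, and
  a failed test is won by the ownship; in \<open>dia \<alpha> Q\<close> the choices belong to the ownship, and
  a failed test is lost by the ownship. Duality switches between the two.
  A strategy is thus a choice of witness at every existential quantifier or disjunction, and
  may depend on everything played so far.
  For a loop controlled by the opponent the region is a greatest fixed point: the ownship has
  to be able to continue from round to round such that \<open>Q\<close> holds whenever the opponent stops.
  A loop controlled by the ownship has to be stopped eventually.
\<close>

fun box :: "'v game \<Rightarrow> 'v fml \<Rightarrow> 'v fml"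
  and dia :: "'v game \<Rightarrow> 'v fml \<Rightarrow> 'v fml" where
  "box (Assign x e) Q = (\<lambda>s. Q (s(x := e s)))"
| "box (AssignAny x) Q = (\<lambda>s. \<forall>a. Q (s(x := a)))"
| "box (Test P) Q = (\<lambda>s. P s \<longrightarrow> Q s)"
| "box (\<alpha> \<^bold>; \<beta>) Q = box \<alpha> (box \<beta> Q)"
| "box (\<alpha> \<^bold>\<union> \<beta>) Q = (\<lambda>s. box \<alpha> Q s \<and> box \<beta> Q s)"
| "box (Loop \<alpha>) Q = gfp (\<lambda>Z s. Q s \<and> box \<alpha> Z s)"
| "box (ODE f D) Q = (\<lambda>s. \<forall>T\<ge>0. \<forall>\<phi>. \<phi> 0 = s \<and> follows f D T \<phi> \<longrightarrow> Q (\<phi> T))"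
| "box (Dual \<alpha>) Q = dia \<alpha> Q"
| "dia (Assign x e) Q = (\<lambda>s. Q (s(x := e s)))"
| "dia (AssignAny x) Q = (\<lambda>s. \<exists>a. Q (s(x := a)))"
| "dia (Test P) Q = (\<lambda>s. P s \<and> Q s)"
| "dia (\<alpha> \<^bold>; \<beta>) Q = dia \<alpha> (dia \<beta> Q)"
| "dia (\<alpha> \<^bold>\<union> \<beta>) Q = (\<lambda>s. dia \<alpha> Q s \<or> dia \<beta> Q s)"
| "dia (Loop \<alpha>) Q = lfp (\<lambda>Z s. Q s \<or> dia \<alpha> Z s)"
| "dia (ODE f D) Q = (\<lambda>s. \<exists>T\<ge>0. \<exists>\<phi>. \<phi> 0 = s \<and> follows f D T \<phi> \<and> Q (\<phi> T))"
| "dia (Dual \<alpha>) Q = box \<alpha> Q"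

definition valid :: "'v fml \<Rightarrow> bool" where
  "valid P \<longleftrightarrow> (\<forall>s. P s)"

section \<open>The collision avoidance model\<close>

text \<open>
  All variables are real-valued, so the pair-valued advisory \<open>adv\<close> is stored in the two
  variables \<open>Adv_w\<close> and \<open>Adv_vlo\<close>. The quantities that no game changes
  (\<open>rp\<close>, \<open>hp\<close>, \<open>rv\<close>, \<open>alo\<close>, \<open>amax\<close>, \<open>c\<close>) are parameters.
\<close>

datatype var = R | H | V | W | V_lo | A_o | A_i | Adv_w | Adv_vlo

definition T_lo :: "real \<Rightarrow> real \<Rightarrow> real \<Rightarrow> real \<Rightarrow> real" where
  "T_lo alo v w vlo = max 0 (w * (vlo - v)) / alo"

definition A_lo :: "real \<Rightarrow> real \<Rightarrow> real \<Rightarrow> real \<Rightarrow> real \<Rightarrow> real \<Rightarrow> bool" where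
  "A_lo alo v w vlo hn t \<longleftrightarrow>
     (0 \<le> t \<and> t < T_lo alo v w vlo \<and> hn = w * alo / 2 * t\<^sup>2 + v * t) \<or>
     (t \<ge> T_lo alo v w vlo \<and> hn = vlo * t - w * (max 0 (w * (vlo - v)))\<^sup>2 / (2 * alo))"

definition L_impl_inv ::
  "real \<Rightarrow> real \<Rightarrow> real \<Rightarrow> real \<Rightarrow> real \<Rightarrow> real \<Rightarrow> real \<Rightarrow> real \<Rightarrow> real \<Rightarrow> bool" where
  "L_impl_inv rp hp rv alo r h v w vlo \<longleftrightarrow>
     (\<forall>t rn hn. rn = rv * t \<and> A_lo alo v w vlo hn t \<longrightarrow>
        \<bar>r - rn\<bar> > rp \<or> w * (hn - h) > hp)"

definition alpha2 :: "real \<Rightarrow> real \<Rightarrow> real \<Rightarrow> real \<Rightarrow> real \<Rightarrow> real \<Rightarrow> var game" where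
  "alpha2 rp hp rv alo amax c =
     (Test (\<lambda>s. True) \<^bold>\<union>
        ((Assign W (\<lambda>s. 1) \<^bold>\<union> Assign W (\<lambda>s. -1)) \<^bold>;
         AssignAny V_lo \<^bold>;
         Test (\<lambda>s. L_impl_inv rp hp rv alo (s R) (s H) (s V) (s W) (s V_lo)) \<^bold>;
         Assign Adv_w (\<lambda>s. s W) \<^bold>; Assign Adv_vlo (\<lambda>s. s V_lo))) \<^bold>;
     Dual (AssignAny A_o \<^bold>; Test (\<lambda>s. - amax \<le> s A_o \<and> s A_o \<le> amax)) \<^bold>;
     Loop (AssignAny A_i \<^bold>; Test (\<lambda>s. - c < s A_i \<and> s A_i < c) \<^bold>;
           ODE [R \<mapsto> (\<lambda>s. - rv), H \<mapsto> (\<lambda>s. - s V), V \<mapsto> (\<lambda>s. s A_o - s A_i)] (\<lambda>s. True))"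

end

theory Submission imports "HOL-Analysis.Derivative" Defs begin

text \<open>
  In direction \<open>w\<close>, the nominal height at time \<open>t\<close> is the integral of
  \<open>min (w * v + alo * s) (w * vlo)\<close> over \<open>s\<close> from \<open>0\<close> to \<open>t\<close>, hence the minimum over switching times
  \<open>\<sigma> \<in> {0..t}\<close> of the height reached by accelerating at rate \<open>alo\<close> up to \<open>\<sigma>\<close> and then
  moving at velocity \<open>vlo\<close>. In this form the safe region is visibly preserved by every
  motion whose relative acceleration in direction \<open>w\<close> is at least \<open>alo\<close>: a plan that
  switches \<open>\<sigma>\<close> after such a motion of duration \<open>T\<close> dominates the original plan that
  switches at \<open>T + \<sigma>\<close>. The ownship therefore always picks the acceleration \<open>w * amax\<close>, which
  leaves at least \<open>alo\<close> in direction \<open>w\<close> whatever the intruder does.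
\<close>

definition switch_height :: "real \<Rightarrow> real \<Rightarrow> real \<Rightarrow> real \<Rightarrow> real \<Rightarrow> real" where
  "switch_height alo u l t \<sigma> = u * \<sigma> + alo / 2 * \<sigma>\<^sup>2 + l * (t - \<sigma>)"

text \<open>Let \<open>m = max 0 (w * (vlo - v))\<close> be the missing speed. Until it is made up,
  the gap is the integral of \<open>m - alo * s\<close> over \<open>s\<close> from
  \<open>\<sigma>\<close> to \<open>t\<close>, where the integrand is nonnegative. Afterwards the
  gap is at least a completed square, zero at \<open>\<sigma> = m / alo\<close>.\<close>

lemma A_lo_le_switch_height:
  assumes alo: "alo > 0" and w: "w = -1 \<or> w = 1"
    and A: "A_lo alo v w vlo hn t" and \<sigma>: "0 \<le> \<sigma>" "\<sigma> \<le> t"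
  shows "w * hn \<le> switch_height alo (w * v) (w * vlo) t \<sigma>"
proof -
  have ww: "w * w = 1" using w by auto
  define m where "m = max 0 (w * (vlo - v))"
  have mlo: "w * vlo - w * v \<le> m" "0 \<le> m" by (auto simp: m_def algebra_simps)
  have cases: "m = 0 \<or> m = w * vlo - w * v" by (auto simp: m_def max_def algebra_simps)
  consider "t < m / alo" "hn = w * alo / 2 * t\<^sup>2 + v * t"
    | "t \<ge> m / alo" "hn = vlo * t - w * m\<^sup>2 / (2 * alo)"
    using A unfolding A_lo_def T_lo_def m_def by blast
  then show ?thesis
  proof cases
    case 1
    have t: "alo * t < m" using 1 alo by (simp add: field_simps)
    have "m \<noteq> 0" using 1 \<sigma> alo by auto
    then have m: "m = w * vlo - w * v" using cases by blast
    have "w * hn = (w * w) * (alo / 2 * t\<^sup>2) + w * v * t"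
      using 1 by (simp add: algebra_simps)
    then have hn: "w * hn = alo / 2 * t\<^sup>2 + w * v * t" using ww by simp
    have "switch_height alo (w * v) (w * vlo) t \<sigma> - w * hn = (t - \<sigma>) * (m - alo * (t + \<sigma>) / 2)"
      unfolding hn switch_height_def m by (simp add: field_simps power2_eq_square)
    moreover have "alo * (t + \<sigma>) / 2 \<le> alo * t" using \<sigma> alo by simp
    then have "(t - \<sigma>) * (m - alo * (t + \<sigma>) / 2) \<ge> 0" using t \<sigma> by simp
    ultimately show ?thesis by simp
  next
    case 2
    have "w * hn = w * vlo * t - (w * w) * (m\<^sup>2 / (2 * alo))"
      unfolding 2(2) by (simp add: algebra_simps)
    then have hn: "w * hn = w * vlo * t - m\<^sup>2 / (2 * alo)" using ww by simp
    have "(w * vlo - w * v) * \<sigma> \<le> m * \<sigma>" using mlo \<sigma> by (simp add: mult_right_mono)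
    moreover have "alo / 2 * \<sigma>\<^sup>2 - m * \<sigma> + m\<^sup>2 / (2 * alo) = (alo * \<sigma> - m)\<^sup>2 / (2 * alo)"
      using alo by (simp add: field_simps power2_eq_square)
    moreover have "(alo * \<sigma> - m)\<^sup>2 / (2 * alo) \<ge> 0" using alo by simp
    ultimately show ?thesis unfolding hn switch_height_def by (simp add: algebra_simps)
  qed
qed

text \<open>The optimal switching time is \<open>t\<close> during the acceleration phase and
  \<open>T_lo\<close> after it.\<close>

lemma A_lo_attains_switch_height:
  assumes alo: "alo > 0" and w: "w = -1 \<or> w = 1" and A: "A_lo alo v w vlo hn t"
  obtains \<sigma> where "0 \<le> \<sigma>" "\<sigma> \<le> t" "w * hn = switch_height alo (w * v) (w * vlo) t \<sigma>"
proof -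
  have ww: "w * w = 1" using w by auto
  define m where "m = max 0 (w * (vlo - v))"
  have cases: "m = 0 \<or> m = w * vlo - w * v" "0 \<le> m"
    by (auto simp: m_def max_def algebra_simps)
  consider "0 \<le> t" "hn = w * alo / 2 * t\<^sup>2 + v * t"
    | "t \<ge> m / alo" "hn = vlo * t - w * m\<^sup>2 / (2 * alo)"
    using A unfolding A_lo_def T_lo_def m_def by blast
  then show ?thesis
  proof cases
    case 1
    have "w * hn = (w * w) * (alo / 2 * t\<^sup>2) + w * v * t"
      using 1 by (simp add: algebra_simps)
    with 1 ww show ?thesis by (intro that[of t]) (auto simp: switch_height_def)
  next
    case 2
    have "w * hn = w * vlo * t - (w * w) * (m\<^sup>2 / (2 * alo))"
      unfolding 2(2) by (simp add: algebra_simps)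
    then have hn: "w * hn = w * vlo * t - m\<^sup>2 / (2 * alo)" using ww by simp
    have "switch_height alo (w * v) (w * vlo) t (m / alo)
        = w * vlo * t - (w * vlo - w * v) * (m / alo) + m\<^sup>2 / (2 * alo)"
      using alo by (simp add: switch_height_def field_simps power2_eq_square)
    \<comment> \<open>If the target speed is already exceeded, \<open>m = 0\<close> and both sides
      vanish; otherwise \<open>m\<close> is the first factor.\<close>
    also have "(w * vlo - w * v) * (m / alo) = m\<^sup>2 / alo"
      using cases(1) by (auto simp: power2_eq_square)
    also have "w * vlo * t - m\<^sup>2 / alo + m\<^sup>2 / (2 * alo) = w * hn"
      unfolding hn using alo by (simp add: field_simps)
    finally have "w * hn = switch_height alo (w * v) (w * vlo) t (m / alo)" ..
    then show ?thesis using 2 alo cases(2) by (intro that[of "m / alo"]) auto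
  qed
qed

text \<open>Ensures that the quantifier over \<open>hn\<close> in \<open>L_impl_inv\<close> is not
  vacuous at any nonnegative time.\<close>

lemma A_lo_exists:
  assumes "t \<ge> 0"
  obtains hn where "A_lo alo v w vlo hn t"
  using assms unfolding A_lo_def by (cases "t < T_lo alo v w vlo") auto

text \<open>A minimum exceeds a bound iff all candidates do, and the horizontal alternative does not
  depend on \<open>\<sigma>\<close>.\<close>

lemma L_impl_inv_iff_switch_height:
  assumes alo: "alo > 0" and w: "w = -1 \<or> w = 1"
  shows "L_impl_inv rp hp rv alo r h v w vlo \<longleftrightarrow>
    (\<forall>t \<sigma>. 0 \<le> \<sigma> \<longrightarrow> \<sigma> \<le> t \<longrightarrow>
       \<bar>r - rv * t\<bar> > rp \<or> switch_height alo (w * v) (w * vlo) t \<sigma> - w * h > hp)"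
    (is "_ \<longleftrightarrow> ?S")
proof
  assume L: "L_impl_inv rp hp rv alo r h v w vlo"
  show ?S
  proof (intro allI impI)
    fix t \<sigma> :: real
    assume \<sigma>: "0 \<le> \<sigma>" "\<sigma> \<le> t"
    then obtain hn where A: "A_lo alo v w vlo hn t" by (meson A_lo_exists order_trans)
    then have "\<bar>r - rv * t\<bar> > rp \<or> w * hn - w * h > hp"
      using L by (auto simp: L_impl_inv_def right_diff_distrib)
    then show "\<bar>r - rv * t\<bar> > rp \<or> switch_height alo (w * v) (w * vlo) t \<sigma> - w * h > hp"
      using A_lo_le_switch_height[OF alo w A \<sigma>] by linarith
  qed
next
  assume ?S
  then show "L_impl_inv rp hp rv alo r h v w vlo"
    unfolding L_impl_inv_def right_diff_distrib
    by (metis A_lo_attains_switch_height[OF alo w])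
qed

text \<open>At \<open>t = \<sigma> = 0\<close> every plan still has height 0, so the region speaks
  about the current separation.\<close>

lemma L_impl_inv_safe:
  assumes "alo > 0" "w = -1 \<or> w = 1" "L_impl_inv rp hp rv alo r h v w vlo"
  shows "\<bar>r\<bar> > rp \<or> \<bar>h\<bar> > hp"
proof -
  have "\<bar>r\<bar> > rp \<or> - (w * h) > hp"
    using assms(3)[unfolded L_impl_inv_iff_switch_height[OF assms(1,2)], rule_format, of 0 0]
    by (simp add: switch_height_def)
  then show ?thesis using assms(2) by auto
qed

lemma L_impl_inv_accelerate:
  assumes alo: "alo > 0" and w: "w = -1 \<or> w = 1"
    and L: "L_impl_inv rp hp rv alo r h v w vlo"
    and a: "w * a \<ge> alo" and T: "T \<ge> 0"
  shows "L_impl_inv rp hp rv alo (r - rv * T) (h - v * T - a / 2 * T\<^sup>2) (v + a * T) w vlo"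
  unfolding L_impl_inv_iff_switch_height[OF alo w]
proof (intro allI impI)
  fix t \<sigma> :: real
  assume \<sigma>: "0 \<le> \<sigma>" "\<sigma> \<le> t"
  \<comment> \<open>The surplus acceleration \<open>w * a - alo\<close> gains height at rate
    \<open>T\<^sup>2 / 2\<close> during the motion, and the extra speed it leaves acts for a further
    time \<open>\<sigma>\<close>; after the switch both plans move at \<open>vlo\<close>.\<close>
  have "switch_height alo (w * (v + a * T)) (w * vlo) t \<sigma> - w * (h - v * T - a / 2 * T\<^sup>2)
      - (switch_height alo (w * v) (w * vlo) (T + t) (T + \<sigma>) - w * h)
      = (w * a - alo) * (T * \<sigma> + T\<^sup>2 / 2)"
    by (simp add: switch_height_def field_simps power2_eq_square)
  also have "\<dots> \<ge> 0" using a T \<sigma> by simp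
  finally have "switch_height alo (w * v) (w * vlo) (T + t) (T + \<sigma>) - w * h
      \<le> switch_height alo (w * (v + a * T)) (w * vlo) t \<sigma> - w * (h - v * T - a / 2 * T\<^sup>2)"
    by simp
  moreover have "\<bar>r - rv * (T + t)\<bar> > rp \<or>
      switch_height alo (w * v) (w * vlo) (T + t) (T + \<sigma>) - w * h > hp"
    using L[unfolded L_impl_inv_iff_switch_height[OF alo w]] \<sigma> T by simp
  ultimately show "\<bar>r - rv * T - rv * t\<bar> > rp \<or>
      switch_height alo (w * (v + a * T)) (w * vlo) t \<sigma> - w * (h - v * T - a / 2 * T\<^sup>2) > hp"
    by (simp add: algebra_simps) linarith
qed

lemma same_derivative_diff_eq:
  fixes f g :: "real \<Rightarrow> real"
  assumes "\<And>t. t \<in> {0..T} \<Longrightarrow> (f has_real_derivative f' t) (at t within {0..T})"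
    and "\<And>t. t \<in> {0..T} \<Longrightarrow> (g has_real_derivative f' t) (at t within {0..T})"
    and "t \<in> {0..T}"
  shows "f t - g t = f 0 - g 0"
proof -
  have "((\<lambda>t. f t - g t) has_real_derivative 0) (at t within {0..T})" if "t \<in> {0..T}" for t
    using DERIV_diff[OF assms(1,2)[OF that]] by simp
  then obtain k where "\<forall>t\<in>{0..T}. f t - g t = k"
    using has_field_derivative_zero_constant[of "{0..T}" "\<lambda>t. f t - g t"] by auto
  then show ?thesis using assms(3) by auto
qed

text \<open>The system is triangular: \<open>A_o\<close> and \<open>A_i\<close> are constant, which
  determines \<open>V\<close>, which in turn determines \<open>H\<close>. Each component is compared
  with a polynomial of the same derivative.\<close>

lemma follows_solution:
  assumes f: "follows [R \<mapsto> (\<lambda>s. - rv), H \<mapsto> (\<lambda>s. - s V), V \<mapsto> (\<lambda>s. s A_o - s A_i)] D T \<phi>"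
    and T: "T \<ge> 0"
  defines "a \<equiv> \<phi> 0 A_o - \<phi> 0 A_i"
  shows "\<phi> T R = \<phi> 0 R - rv * T"
    and "\<phi> T V = \<phi> 0 V + a * T"
    and "\<phi> T H = \<phi> 0 H - \<phi> 0 V * T - a / 2 * T\<^sup>2"
    and "x \<notin> {R, H, V} \<Longrightarrow> \<phi> T x = \<phi> 0 x"
proof -
  note F = f[unfolded follows_def, rule_format, THEN conjunct2, rule_format]
  have const: "\<phi> t x = \<phi> 0 x" if "t \<in> {0..T}" "x \<notin> {R, H, V}" for t x
    using F[OF that(1), of x] that(2) by auto
  show "x \<notin> {R, H, V} \<Longrightarrow> \<phi> T x = \<phi> 0 x" using const[of T x] T by simp
  have "\<phi> T R - (- rv * T) = \<phi> 0 R - (- rv * 0)"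
  proof (rule same_derivative_diff_eq[where f' = "\<lambda>_. - rv" and T = T])
    show "((\<lambda>t. \<phi> t R) has_real_derivative - rv) (at t within {0..T})" if "t \<in> {0..T}" for t
      using F[OF that, of R] by simp
  qed (use T in \<open>auto intro!: derivative_eq_intros\<close>)
  then show "\<phi> T R = \<phi> 0 R - rv * T" by simp
  have V: "\<phi> t V = \<phi> 0 V + a * t" if "t \<in> {0..T}" for t
  proof -
    have "\<phi> t V - a * t = \<phi> 0 V - a * 0"
    proof (rule same_derivative_diff_eq[where f' = "\<lambda>_. a" and T = T])
      show "((\<lambda>t. \<phi> t V) has_real_derivative a) (at t within {0..T})" if "t \<in> {0..T}" for t
        using F[OF that, of V] const[OF that, of A_o] const[OF that, of A_i] by (simp add: a_def)
    qed (use that in \<open>auto intro!: derivative_eq_intros\<close>)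
    then show ?thesis by simp
  qed
  show "\<phi> T V = \<phi> 0 V + a * T" using V[of T] T by simp
  have "\<phi> T H - (- \<phi> 0 V * T - a / 2 * T\<^sup>2) = \<phi> 0 H - (- \<phi> 0 V * 0 - a / 2 * 0\<^sup>2)"
  proof (rule same_derivative_diff_eq[where f' = "\<lambda>t. - (\<phi> 0 V + a * t)" and T = T])
    show "((\<lambda>t. \<phi> t H) has_real_derivative - (\<phi> 0 V + a * t)) (at t within {0..T})"
      if "t \<in> {0..T}" for t
      using F[OF that, of H] V[OF that] by simp
  qed (use T in \<open>auto intro!: derivative_eq_intros\<close>)
  then show "\<phi> T H = \<phi> 0 H - \<phi> 0 V * T - a / 2 * T\<^sup>2" by simp
qed

text \<open>Coinduction: an invariant is a post-fixed point, hence below the greatest fixed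
  point.\<close>

lemma box_LoopI:
  assumes "J s" and "\<And>s. J s \<Longrightarrow> Q s" and "\<And>s. J s \<Longrightarrow> box \<alpha> J s"
  shows "box (Loop \<alpha>) Q s"
proof -
  have "J \<le> gfp (\<lambda>Z s. Q s \<and> box \<alpha> Z s)"
    by (rule gfp_upperbound) (use assms(2,3) in auto)
  then show ?thesis using assms(1) by auto
qed

text \<open>The invariant of the outer loop. A new advisory re-establishes it, by the choice of
  \<open>W\<close> and the test that follows.\<close>

definition safe_state :: "real \<Rightarrow> real \<Rightarrow> real \<Rightarrow> real \<Rightarrow> var fml" where
  "safe_state rp hp rv alo s \<longleftrightarrow> (s W = -1 \<or> s W = 1) \<and>
     L_impl_inv rp hp rv alo (s R) (s H) (s V) (s W) (s V_lo)"

lemma safe_state_ODE: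
  assumes alo: "alo > 0" and amax: "amax \<ge> alo + c"
    and s: "safe_state rp hp rv alo s" and ao: "s A_o = s W * amax"
    and ai: "- c < s A_i" "s A_i < c"
  shows "box (ODE [R \<mapsto> (\<lambda>s. - rv), H \<mapsto> (\<lambda>s. - s V), V \<mapsto> (\<lambda>s. s A_o - s A_i)] (\<lambda>s. True))
    (\<lambda>s. safe_state rp hp rv alo s \<and> s A_o = s W * amax) s"
proof (simp only: box.simps, intro allI impI, elim conjE)
  fix T \<phi>
  assume T: "T \<ge> (0::real)" and \<phi>: "\<phi> 0 = s"
    and f: "follows [R \<mapsto> (\<lambda>s. - rv), H \<mapsto> (\<lambda>s. - s V), V \<mapsto> (\<lambda>s. s A_o - s A_i)]
              (\<lambda>s. True) T \<phi>"
  have w: "s W = -1 \<or> s W = 1"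
    and L: "L_impl_inv rp hp rv alo (s R) (s H) (s V) (s W) (s V_lo)"
    using s by (auto simp: safe_state_def)
  \<comment> \<open>As \<open>s W\<close> squares to 1, the left side is
    \<open>amax - s W * s A_i\<close>, which exceeds \<open>amax - c\<close>.\<close>
  have "s W * (s A_o - s A_i) \<ge> alo" using w ao ai amax by auto
  from L_impl_inv_accelerate[OF alo w L this T]
  show "safe_state rp hp rv alo (\<phi> T) \<and> \<phi> T A_o = \<phi> T W * amax"
    using w ao by (simp add: safe_state_def follows_solution[OF f T] \<phi>)
qed

lemma safe_state_alpha2:
  assumes alo: "alo > 0" and c: "c > 0" and amax: "amax \<ge> alo + c"
    and s: "safe_state rp hp rv alo s"
  shows "box (alpha2 rp hp rv alo amax c) (safe_state rp hp rv alo) s"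
proof -
  define \<beta> where "\<beta> = (AssignAny A_i \<^bold>; Test (\<lambda>s. - c < s A_i \<and> s A_i < c) \<^bold>;
    ODE [R \<mapsto> (\<lambda>s. - rv), H \<mapsto> (\<lambda>s. - s V), V \<mapsto> (\<lambda>s. s A_o - s A_i)] (\<lambda>s. True))"
  have loop: "box (Loop \<beta>) (safe_state rp hp rv alo) s"
    if "safe_state rp hp rv alo s" "s A_o = s W * amax" for s
  \<comment> \<open>The inner invariant also records the ownship's choice, which stays in force
    throughout the intruder's rounds.\<close>
  proof (rule box_LoopI[where J = "\<lambda>s. safe_state rp hp rv alo s \<and> s A_o = s W * amax"])
    fix s
    assume J: "safe_state rp hp rv alo s \<and> s A_o = s W * amax"
    show "box \<beta> (\<lambda>s. safe_state rp hp rv alo s \<and> s A_o = s W * amax) s"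
      unfolding \<beta>_def box.simps(2-4)
      by (intro allI impI safe_state_ODE[OF alo amax]) (use J in \<open>auto simp: safe_state_def\<close>)
  qed (use that in auto)
  \<comment> \<open>The ownship's move under \<open>Dual\<close>. It is treated for every safe state
    because the advisory may have changed just before.\<close>
  have "\<exists>a. (- amax \<le> a \<and> a \<le> amax) \<and> box (Loop \<beta>) (safe_state rp hp rv alo) (s(A_o := a))"
    if "safe_state rp hp rv alo s" for s
  proof (intro exI conjI)
    show "- amax \<le> s W * amax" "s W * amax \<le> amax"
      using that alo c amax by (auto simp: safe_state_def)
    show "box (Loop \<beta>) (safe_state rp hp rv alo) (s(A_o := s W * amax))"
      using that by (intro loop) (auto simp: safe_state_def)
  qed
  \<comment> \<open>Without the fixed-point equation \<open>box.simps(6)\<close> the inner loop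
    stays folded and matches the fact just shown.\<close>
  then show ?thesis
    using s unfolding alpha2_def \<beta>_def[symmetric]
    by (auto simp del: box.simps(6) simp: safe_state_def)
qed

theorem theorem4p1:
  fixes rp hp rv alo amax c :: real
  shows "valid (\<lambda>s.
    rp \<ge> 0 \<and> hp > 0 \<and> rv \<ge> 0 \<and> alo > 0 \<and> c > 0 \<and> (s W = -1 \<or> s W = 1) \<and>
    amax \<ge> alo + c \<and> L_impl_inv rp hp rv alo (s R) (s H) (s V) (s W) (s V_lo)
    \<longrightarrow> box (Loop (alpha2 rp hp rv alo amax c)) (\<lambda>s. \<bar>s R\<bar> > rp \<or> \<bar>s H\<bar> > hp) s)"
  unfolding valid_def
proof (intro allI impI, elim conjE)
  fix s :: "var state"
  assume "alo > 0" "c > 0" "amax \<ge> alo + c" "s W = -1 \<or> s W = 1"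
    "L_impl_inv rp hp rv alo (s R) (s H) (s V) (s W) (s V_lo)"
  then show "box (Loop (alpha2 rp hp rv alo amax c)) (\<lambda>s. \<bar>s R\<bar> > rp \<or> \<bar>s H\<bar> > hp) s"
    by (intro box_LoopI[where J = "safe_state rp hp rv alo"])
      (auto simp: safe_state_alpha2 safe_state_def dest: L_impl_inv_safe[rotated 2])
qed

end
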